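(* Let $\mathcal{G}$ be a group admitting a faithful representation by $n\times n$ tropical matrices (i.e. $\mathcal{G}$ is isomorphic to a subgroup of the semigroup $(\overline{\mathbb{R}}^{n\times n},\otimes)$). Then $\mathcal{G}$ has a torsion-free abelian subgroup of index at most $n!$.
   Context: The tropical semiring is $\overline{\mathbb{R}}=\mathbb{R}\cup\{-\infty\}$ with $a\oplus b=\max\{a,b\}$ and $a\otimes b=a+b$. Tropical matrix multiplication: $(X\otimes Y)_{ij}=\max_k (x_{ik}+y_{kj})$. A subgroup of the semigroup $(\overline{\mathbb{R}}^{n\times n},\otimes)$ is a subset that is a group under $\otimes$ (its identity need not be the tropical identity matrix). *)

theory Defs
  imports "HOL-Analysis.Analysis" "HOL-Algebra.Coset"
begin

datatype trop = MInf | Fin real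

instantiation trop :: linorder
begin

fun less_eq_trop :: "trop \<Rightarrow> trop \<Rightarrow> bool" where
  "MInf \<le> y \<longleftrightarrow> True"
| "Fin a \<le> MInf \<longleftrightarrow> False"
| "Fin a \<le> Fin b \<longleftrightarrow> a \<le> b"

definition less_trop :: "trop \<Rightarrow> trop \<Rightarrow> bool" where
  "x < y \<longleftrightarrow> x \<le> y \<and> \<not> y \<le> (x :: trop)"

instance
proof
  fix x y z :: trop
  show "x < y \<longleftrightarrow> x \<le> y \<and> \<not> y \<le> x" by (rule less_trop_def)
  show "x \<le> x" by (cases x) auto
  show "x \<le> y \<Longrightarrow> y \<le> z \<Longrightarrow> x \<le> z" by (cases x; cases y; cases z) auto
  show "x \<le> y \<Longrightarrow> y \<le> x \<Longrightarrow> x = y" by (cases x; cases y) auto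
  show "x \<le> y \<or> y \<le> x" by (cases x; cases y) auto
qed

end

text \<open>In the class notation, \<open>+\<close> is tropical addition (maximum), \<open>*\<close> is tropical
  multiplication (addition of reals), \<open>0\<close> is minus infinity and \<open>1\<close> is the real number zero.
  The library product \<open>**\<close> of matrices over \<open>trop\<close> is therefore the tropical one; see
  \<open>trop_matrix_mult_nth\<close> below.\<close>

instantiation trop :: comm_semiring_1
begin

definition zero_trop :: trop where "0 = MInf"

definition one_trop :: trop where "1 = Fin 0"

definition plus_trop :: "trop \<Rightarrow> trop \<Rightarrow> trop" where "x + y = max x (y :: trop)"

fun times_trop :: "trop \<Rightarrow> trop \<Rightarrow> trop" where
  "MInf * y = MInf"
| "Fin a * MInf = MInf"
| "Fin a * Fin b = Fin (a + b)"

instance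
proof
  fix x y z :: trop
  show "x + y + z = x + (y + z)" by (simp add: plus_trop_def max.assoc)
  show "x + y = y + x" by (simp add: plus_trop_def max.commute)
  show "0 + x = x" by (cases x) (auto simp: plus_trop_def zero_trop_def max_def)
  show "x * y * z = x * (y * z)" by (cases x; cases y; cases z) auto
  show "x * y = y * x" by (cases x; cases y) auto
  show "1 * x = x" by (cases x) (auto simp: one_trop_def)
  show "(x + y) * z = x * z + y * z"
    by (cases x; cases y; cases z) (auto simp: plus_trop_def max_def)
  show "0 * x = 0" "x * 0 = 0" by (cases x; simp add: zero_trop_def)+
  show "(0::trop) \<noteq> 1" by (simp add: zero_trop_def one_trop_def)
qed

end

lemma trop_zero_le: "0 \<le> (x :: trop)"
  by (simp add: zero_trop_def)

lemma trop_sum_eq_Max: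
  fixes f :: "'k \<Rightarrow> trop"
  assumes "finite S" "S \<noteq> {}"
  shows "sum f S = Max (f ` S)"
  using assms by (induction S rule: finite_ne_induct) (simp_all add: plus_trop_def max_absorb1 trop_zero_le)

lemma trop_matrix_mult_nth:
  fixes X :: "trop ^ 'n ^ 'm" and Y :: "trop ^ 'p ^ 'n"
  shows "(X ** Y) $ i $ j = (MAX k. X $ i $ k * Y $ k $ j)"
  by (simp add: matrix_matrix_mult_def trop_sum_eq_Max)

text \<open>A subgroup of the matrix semigroup is a set \<open>H\<close> for which this structure is a group for some
  \<open>e\<close>. The identity \<open>e\<close> is an arbitrary idempotent matrix, not necessarily \<open>mat 1\<close>.\<close>

definition trop_mat_structure ::
  "(trop ^ 'n ^ 'n) set \<Rightarrow> trop ^ 'n ^ 'n \<Rightarrow> (trop ^ 'n ^ 'n) monoid"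
  where "trop_mat_structure H e = \<lparr>carrier = H, mult = (**), one = e\<rparr>"

definition torsion_free :: "('a, 'b) monoid_scheme \<Rightarrow> bool"
  where "torsion_free G \<longleftrightarrow>
    (\<forall>x \<in> carrier G. \<forall>k::nat. 0 < k \<longrightarrow> x [^]\<^bsub>G\<^esub> k = \<one>\<^bsub>G\<^esub> \<longrightarrow> x = \<one>\<^bsub>G\<^esub>)"

end

theory Submission
  imports Defs
begin

text \<open>The columns of the idempotent \<open>e\<close> contain a minimal generating family \<open>c j\<close>, \<open>j \<in> S\<close>, of the
  column space of \<open>e\<close>. Every element of the group acts invertibly on this space, and tropical
  independence forces it to send each \<open>c j\<close> to a finite multiple of some \<open>c (\<sigma> j)\<close>. The group
  therefore embeds into the wreath product of the additive reals by the symmetric group on \<open>S\<close>, and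
  the elements inducing the trivial permutation form the required subgroup.\<close>

section \<open>Subgroups of wreath products of the reals by a symmetric group\<close>

text \<open>The pair \<open>\<sigma> g\<close>, \<open>w g\<close> describes a monomial
  transformation on \<open>S\<close>, and \<open>w_mult\<close> is the cocycle rule for composing
  two of them. On the kernel \<open>A\<close> of the permutation part this rule becomes additivity,
  so \<open>w\<close> embeds \<open>A\<close> into the additive group of real functions on
  \<open>S\<close>, which is abelian and torsion-free.\<close>

lemma torsion_free_subgroup_from_monomial_action:
  fixes G :: "('a, 'b) monoid_scheme" and \<sigma> :: "'a \<Rightarrow> 'k \<Rightarrow> 'k" and w :: "'a \<Rightarrow> 'k \<Rightarrow> real"
  assumes "group G" and S: "finite S"
    and \<sigma>_in: "\<And>g j. g \<in> carrier G \<Longrightarrow> j \<in> S \<Longrightarrow> \<sigma> g j \<in> S"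
    and \<sigma>_one: "\<And>j. j \<in> S \<Longrightarrow> \<sigma> \<one>\<^bsub>G\<^esub> j = j"
    and \<sigma>_mult: "\<And>g h j. g \<in> carrier G \<Longrightarrow> h \<in> carrier G \<Longrightarrow> j \<in> S \<Longrightarrow>
      \<sigma> (g \<otimes>\<^bsub>G\<^esub> h) j = \<sigma> g (\<sigma> h j)"
    and w_mult: "\<And>g h j. g \<in> carrier G \<Longrightarrow> h \<in> carrier G \<Longrightarrow> j \<in> S \<Longrightarrow>
      w (g \<otimes>\<^bsub>G\<^esub> h) j = w h j + w g (\<sigma> h j)"
    and faithful: "\<And>g. g \<in> carrier G \<Longrightarrow> (\<And>j. j \<in> S \<Longrightarrow> \<sigma> g j = j \<and> w g j = 0) \<Longrightarrow> g = \<one>\<^bsub>G\<^esub>"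
  shows "\<exists>A. subgroup A G \<and> comm_group (G\<lparr>carrier := A\<rparr>) \<and> torsion_free (G\<lparr>carrier := A\<rparr>)
    \<and> finite (rcosets\<^bsub>G\<^esub> A) \<and> card (rcosets\<^bsub>G\<^esub> A) \<le> fact (card S)"
proof -
  interpret group G by fact
  define A where "A = {g \<in> carrier G. \<forall>j\<in>S. \<sigma> g j = j}"
  have w_one: "w \<one>\<^bsub>G\<^esub> j = 0" if "j \<in> S" for j
    using w_mult[of "\<one>\<^bsub>G\<^esub>" "\<one>\<^bsub>G\<^esub>" j] \<sigma>_one that by simp
  have \<sigma>_inv: "\<sigma> (inv\<^bsub>G\<^esub> g) (\<sigma> g j) = j" "\<sigma> g (\<sigma> (inv\<^bsub>G\<^esub> g) j) = j"
    if "g \<in> carrier G" "j \<in> S" for g j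
    using that \<sigma>_mult[of "inv\<^bsub>G\<^esub> g" g j] \<sigma>_mult[of g "inv\<^bsub>G\<^esub> g" j] \<sigma>_one by auto
  have A_sub: "A \<subseteq> carrier G"
    by (auto simp: A_def)
  have sub: "subgroup A G"
  proof (rule subgroupI)
    show "A \<noteq> {}"
      using \<sigma>_one by (auto simp: A_def)
    show "inv\<^bsub>G\<^esub> a \<in> A" if "a \<in> A" for a
      using that \<sigma>_inv(1)[of a] by (auto simp: A_def)
    show "a \<otimes>\<^bsub>G\<^esub> b \<in> A" if "a \<in> A" "b \<in> A" for a b
      using that by (auto simp: A_def \<sigma>_mult)
  qed (rule A_sub)
  have w_add: "w (a \<otimes>\<^bsub>G\<^esub> b) j = w a j + w b j" if "a \<in> A" "b \<in> A" "j \<in> S" for a b j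
    using that w_mult[of a b j] by (auto simp: A_def)
  \<comment> \<open>Applying \<open>faithful\<close> to the quotient of \<open>a\<close> and
    \<open>b\<close> shows that the weights separate the elements of \<open>A\<close>. Commutativity
    and torsion-freeness can then be checked on real numbers.\<close>
  have A_eqI: "a = b" if "a \<in> A" "b \<in> A" and w_eq: "\<And>j. j \<in> S \<Longrightarrow> w a j = w b j" for a b
  proof -
    have ib: "inv\<^bsub>G\<^esub> b \<in> A"
      using sub that by (simp add: subgroup.m_inv_closed)
    have "a \<otimes>\<^bsub>G\<^esub> inv\<^bsub>G\<^esub> b = \<one>\<^bsub>G\<^esub>"
    proof (rule faithful)
      have *: "a \<otimes>\<^bsub>G\<^esub> inv\<^bsub>G\<^esub> b \<in> A"
        using sub that ib by (simp add: subgroup.m_closed)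
      then show "a \<otimes>\<^bsub>G\<^esub> inv\<^bsub>G\<^esub> b \<in> carrier G"
        using A_sub by blast
      fix j assume j: "j \<in> S"
      have "w (b \<otimes>\<^bsub>G\<^esub> inv\<^bsub>G\<^esub> b) j = 0"
        using w_one[OF j] that A_sub by (simp add: subset_iff)
      then have "w a j + w (inv\<^bsub>G\<^esub> b) j = 0"
        using w_add[OF that(2) ib j] w_eq[OF j] by simp
      then show "\<sigma> (a \<otimes>\<^bsub>G\<^esub> inv\<^bsub>G\<^esub> b) j = j \<and> w (a \<otimes>\<^bsub>G\<^esub> inv\<^bsub>G\<^esub> b) j = 0"
        using * j w_add[OF that(1) ib j] by (auto simp: A_def)
    qed
    then show ?thesis
      using that A_sub by (metis (no_types) ib inv_equality inv_inv subsetD)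
  qed
  have group_A: "group (G\<lparr>carrier := A\<rparr>)"
    by (rule subgroup_imp_group[OF sub])
  have comm: "comm_group (G\<lparr>carrier := A\<rparr>)"
  proof (rule group.group_comm_groupI[OF group_A])
    fix a b assume "a \<in> carrier (G\<lparr>carrier := A\<rparr>)" "b \<in> carrier (G\<lparr>carrier := A\<rparr>)"
    then have ab: "a \<in> A" "b \<in> A" by simp_all
    have "a \<otimes>\<^bsub>G\<^esub> b = b \<otimes>\<^bsub>G\<^esub> a"
      by (rule A_eqI) (use ab sub in \<open>auto simp: w_add subgroup.m_closed\<close>)
    then show "a \<otimes>\<^bsub>G\<lparr>carrier := A\<rparr>\<^esub> b = b \<otimes>\<^bsub>G\<lparr>carrier := A\<rparr>\<^esub> a" by simp
  qed
  have tf: "torsion_free (G\<lparr>carrier := A\<rparr>)"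
    unfolding torsion_free_def
  proof (intro ballI allI impI)
    fix x and k :: nat
    assume "x \<in> carrier (G\<lparr>carrier := A\<rparr>)" and k: "0 < k"
      and pow: "x [^]\<^bsub>G\<lparr>carrier := A\<rparr>\<^esub> k = \<one>\<^bsub>G\<lparr>carrier := A\<rparr>\<^esub>"
    then have x: "x \<in> A" by simp
    have pow_A: "x [^]\<^bsub>G\<lparr>carrier := A\<rparr>\<^esub> m \<in> A" for m :: nat
      using monoid.nat_pow_closed[OF group.is_monoid[OF group_A], of x m] x by simp
    \<comment> \<open>Powers in \<open>A\<close> multiply the weights by the exponent, so a trivial
      power with positive exponent forces all weights to vanish.\<close>
    have w_pow: "w (x [^]\<^bsub>G\<lparr>carrier := A\<rparr>\<^esub> m) j = real m * w x j" if "j \<in> S" for m :: nat and j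
      by (induction m) (use that x pow_A in \<open>auto simp: w_one w_add algebra_simps\<close>)
    have "x = \<one>\<^bsub>G\<^esub>"
    proof (rule A_eqI)
      show "w x j = w \<one>\<^bsub>G\<^esub> j" if "j \<in> S" for j
        using w_pow[OF that, of k] pow k w_one[OF that] by simp
    qed (use x sub in \<open>auto simp: subgroup.one_closed\<close>)
    then show "x = \<one>\<^bsub>G\<lparr>carrier := A\<rparr>\<^esub>" by simp
  qed
  \<comment> \<open>Extending by the identity off \<open>S\<close> gives an honest element of the
    symmetric group on \<open>S\<close>, as \<open>permutes\<close> demands.\<close>
  define perm where "perm g = (\<lambda>j. if j \<in> S then \<sigma> g j else j)" for g
  have perm_permutes: "perm g permutes S" if "g \<in> carrier G" for g
  proof (rule bij_imp_permutes)
    show "bij_betw (perm g) S S"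
      by (rule bij_betw_byWitness[where f' = "\<sigma> (inv\<^bsub>G\<^esub> g)"])
        (use that \<sigma>_in \<sigma>_inv in \<open>auto simp: perm_def\<close>)
  qed (simp add: perm_def)
  \<comment> \<open>The right cosets of \<open>A\<close> turn out to be fibres of
    \<open>perm\<close>, so there are at most as many of them as permutations of
    \<open>S\<close>.\<close>
  define fibre where "fibre p = {g \<in> carrier G. perm g = p}" for p
  have coset: "A #>\<^bsub>G\<^esub> g = fibre (perm g)" if g: "g \<in> carrier G" for g
  proof (intro Set.set_eqI iffI)
    fix x assume "x \<in> A #>\<^bsub>G\<^esub> g"
    then obtain a where "a \<in> A" "x = a \<otimes>\<^bsub>G\<^esub> g"
      by (auto simp: r_coset_def)
    then show "x \<in> fibre (perm g)"
      using g \<sigma>_in by (auto simp: fibre_def perm_def A_def \<sigma>_mult)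
  next
    fix x assume "x \<in> fibre (perm g)"
    then have x: "x \<in> carrier G" and eq: "\<And>j. j \<in> S \<Longrightarrow> \<sigma> x j = \<sigma> g j"
      unfolding fibre_def perm_def by (auto dest: fun_cong split: if_splits)
    have "x \<otimes>\<^bsub>G\<^esub> inv\<^bsub>G\<^esub> g \<in> A"
      using x g \<sigma>_in \<sigma>_inv by (auto simp: A_def \<sigma>_mult eq)
    moreover have "x = (x \<otimes>\<^bsub>G\<^esub> inv\<^bsub>G\<^esub> g) \<otimes>\<^bsub>G\<^esub> g"
      using x g by (simp add: m_assoc)
    ultimately show "x \<in> A #>\<^bsub>G\<^esub> g"
      unfolding r_coset_def by blast
  qed
  have le: "rcosets\<^bsub>G\<^esub> A \<subseteq> fibre ` {p. p permutes S}"
    using coset perm_permutes by (auto simp: RCOSETS_def)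
  have fin: "finite {p. p permutes S}"
    by (rule finite_permutations[OF S])
  have "card (rcosets\<^bsub>G\<^esub> A) \<le> fact (card S)"
    using surj_card_le[OF fin le] card_permutations[OF refl S] by simp
  then show ?thesis
    using sub comm tf finite_subset[OF le finite_imageI[OF fin]] by blast
qed

section \<open>Tropical independence\<close>

text \<open>This is weak independence: no member is a combination of the others. Indexing by a
  family excludes repeated vectors, and the empty combination excludes the zero vector.\<close>

definition trop_independent :: "('k \<Rightarrow> trop ^ 'm) \<Rightarrow> 'k set \<Rightarrow> bool"
  where "trop_independent c S \<longleftrightarrow> (\<forall>j\<in>S. \<forall>b. c j \<noteq> (\<Sum>l\<in>S - {j}. b l *s c l))"

lemma trop_independentD:
  "trop_independent c S \<Longrightarrow> j \<in> S \<Longrightarrow> c j \<noteq> (\<Sum>l\<in>S - {j}. b l *s c l)"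
  unfolding trop_independent_def by blast

text \<open>A generating index set of least cardinality is independent: a member expressible by the
  others could be substituted away, leaving a smaller generating set.\<close>

lemma exists_independent_generators:
  fixes c :: "'k::finite \<Rightarrow> trop ^ 'm"
  obtains S where "trop_independent c S" "\<And>i. \<exists>a. c i = (\<Sum>l\<in>S. a l *s c l)"
proof -
  define gen where "gen S \<longleftrightarrow> (\<forall>i. \<exists>a. c i = (\<Sum>l\<in>S. a l *s c l))" for S
  have "c i = (\<Sum>l\<in>UNIV. (if l = i then 1 else 0) *s c l)" for i
    by (simp add: vec_eq_iff if_distrib[of "\<lambda>x. x * _"] sum.delta cong: if_cong)
  then have "gen UNIV"
    unfolding gen_def by (intro allI exI)
  then obtain S where S: "gen S" and min: "\<And>T. gen T \<Longrightarrow> card S \<le> card T"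
    using ex_has_least_nat[of gen UNIV card] by blast
  have "trop_independent c S"
    unfolding trop_independent_def
  proof (intro ballI allI notI)
    fix j b assume j: "j \<in> S" and b: "c j = (\<Sum>l\<in>S - {j}. b l *s c l)"
    have "\<exists>a. c i = (\<Sum>l\<in>S - {j}. a l *s c l)" for i
    proof -
      obtain a where "c i = (\<Sum>l\<in>S. a l *s c l)"
        using S unfolding gen_def by blast
      also have "\<dots> = a j *s c j + (\<Sum>l\<in>S - {j}. a l *s c l)"
        using j by (simp add: sum.remove)
      also have "\<dots> = (\<Sum>l\<in>S - {j}. (a j * b l + a l) *s c l)"
        by (subst b) (simp add: vec_eq_iff sum_distrib_left sum.distrib algebra_simps)
      finally show ?thesis by (intro exI)
    qed
    then have "card S \<le> card (S - {j})"
      using min unfolding gen_def by blast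
    then show False
      using j by (metis card_Diff1_less finite leD)
  qed
  then show thesis
    using that S unfolding gen_def by blast
qed

lemma trop_independent_nonzero:
  assumes "trop_independent c S" "j \<in> S"
  shows "c j \<noteq> 0"
proof
  assume "c j = 0"
  then have "c j = (\<Sum>l\<in>S - {j}. 0 *s c l)" by simp
  with trop_independentD[OF assms] show False ..
qed

text \<open>Independence provides a coordinate where the remaining terms fall short of
  \<open>c j\<close>. There the maximum comes from \<open>a j *s c j\<close> alone and is finite, so
  it can be cancelled.\<close>

lemma trop_independent_coeff:
  fixes c :: "'k::finite \<Rightarrow> trop ^ 'm"
  assumes ind: "trop_independent c S" and j: "j \<in> S" and eq: "c j = (\<Sum>l\<in>S. a l *s c l)"
  shows "a j = 1"
proof -
  define y where "y = (\<Sum>l\<in>S - {j}. a l *s c l)"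
  have "c j = a j *s c j + y"
    unfolding y_def by (rule trans[OF eq]) (rule sum.remove[OF finite j])
  then have comp: "c j $ i = max (a j * c j $ i) (y $ i)" for i
    using vec_eq_iff[of "c j" "a j *s c j + y"] by (simp add: plus_trop_def)
  have "c j \<noteq> y"
    unfolding y_def by (rule trop_independentD[OF ind j])
  then obtain i where i: "c j $ i \<noteq> y $ i"
    by (auto simp: vec_eq_iff)
  then have "c j $ i = a j * c j $ i"
    using comp[of i] by (auto simp: max_def split: if_splits)
  \<comment> \<open>The entry strictly exceeds \<open>y $ i\<close>, hence lies above minus
    infinity.\<close>
  moreover have "c j $ i \<noteq> MInf"
    using comp[of i] i by (cases "y $ i") (auto simp: max_def split: if_splits)
  ultimately show ?thesis
    by (cases "a j"; cases "c j $ i") (auto simp: one_trop_def)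
qed

text \<open>Finite scalars are invertible, so for \<open>j \<noteq> k\<close> the vector
  \<open>c j\<close> would be a multiple of another member; for \<open>j = k\<close> the scalars are
  compared at a finite coordinate. This uniqueness makes the permutation and weights of a group
  element well defined.\<close>

lemma trop_independent_multiples:
  fixes c :: "'k::finite \<Rightarrow> trop ^ 'm"
  assumes ind: "trop_independent c S" and jk: "j \<in> S" "k \<in> S"
    and eq: "Fin r *s c j = Fin s *s c k"
  shows "j = k \<and> r = s"
proof -
  have "Fin (- r) *s (Fin r *s c j) = c j"
    by (simp add: vector_smult_assoc flip: one_trop_def)
  then have cj: "c j = Fin (s - r) *s c k"
    by (simp add: eq vector_smult_assoc)
  have "c j = (\<Sum>l\<in>S - {j}. (if l = k then Fin (s - r) else 0) *s c l)" if "j \<noteq> k"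
    using that jk cj
    by (simp add: vec_eq_iff if_distrib[of "\<lambda>x. x * _"] sum.delta cong: if_cong)
  then have "j = k"
    using trop_independentD[OF ind jk(1), of "\<lambda>l. if l = k then Fin (s - r) else 0"] by blast
  moreover obtain i where "c j $ i \<noteq> MInf"
    using trop_independent_nonzero[OF ind jk(1)] by (auto simp: vec_eq_iff zero_trop_def)
  then have "s - r = 0"
    using arg_cong[OF cj, of "\<lambda>v. v $ i"] \<open>j = k\<close> by (cases "c j $ i") auto
  ultimately show ?thesis by simp
qed

section \<open>Invertible actions on the column space\<close>

lemma trop_member_le_sum:
  fixes f :: "'k \<Rightarrow> trop"
  assumes "finite S" "k \<in> S"
  shows "f k \<le> sum f S"
  using assms by (simp add: sum.remove plus_trop_def)

lemma trop_sum_attained: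
  fixes f :: "'k \<Rightarrow> trop"
  assumes "finite S" "sum f S \<noteq> 0"
  obtains k where "k \<in> S" "f k = sum f S"
proof -
  have "S \<noteq> {}"
    using assms by auto
  then have "Max (f ` S) \<in> f ` S"
    using assms by simp
  with that show thesis
    using trop_sum_eq_Max[OF assms(1) \<open>S \<noteq> {}\<close>, of f] by force
qed

lemma trop_mult_left_mono: "x \<le> y \<Longrightarrow> z * x \<le> z * (y::trop)"
  by (cases x; cases y; cases z) auto

text \<open>Maximum and translation both preserve the order. An inequality between vectors can
  therefore be transported by a group element.\<close>

lemma trop_matrix_mult_mono:
  fixes X :: "trop ^ 'n ^ 'm"
  assumes "\<And>i. x $ i \<le> y $ i"
  shows "(X *v x) $ i \<le> (X *v y) $ i"
proof -
  have "X $ i $ k * x $ k \<le> X $ i $ k * y $ k" for k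
    by (rule trop_mult_left_mono[OF assms])
  then have "X $ i $ k * x $ k \<le> (\<Sum>k\<in>UNIV. X $ i $ k * y $ k)" for k
    by (rule order_trans) (rule trop_member_le_sum; simp)
  then show ?thesis
    unfolding matrix_vector_mult_def by (simp add: trop_sum_eq_Max)
qed

lemma matrix_vector_mult_smult:
  fixes X :: "'a::comm_semiring_1 ^ 'n ^ 'm"
  shows "X *v (a *s x) = a *s (X *v x)"
  by (simp add: vec_eq_iff matrix_vector_mult_def sum_distrib_left algebra_simps)

lemma matrix_vector_mult_sum_smult:
  fixes X :: "'a::comm_semiring_1 ^ 'n ^ 'm"
  shows "X *v (\<Sum>l\<in>S. a l *s x l) = (\<Sum>l\<in>S. a l *s (X *v x l))"
  by (induction S rule: infinite_finite_induct)
    (simp_all add: matrix_vector_right_distrib matrix_vector_mult_smult)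

lemma column_matrix_mult: "column j (X ** Y) = X *v column j Y"
  by (simp add: vec_eq_iff column_def matrix_matrix_mult_def matrix_vector_mult_def)

text \<open>A tropical counterpart of the fact that an invertible linear map of a cone permutes its
  extremal rays. Going forth by \<open>X\<close> and back by \<open>Y\<close> must reproduce
  \<open>c j\<close> with coefficient \<open>1\<close>, and since a tropical sum is a maximum, a
  single intermediate generator \<open>c k\<close> already achieves this.\<close>

lemma invertible_action_monomial:
  fixes e X Y :: "trop ^ 'n ^ 'n"
  defines "c \<equiv> \<lambda>j. column j e"
  assumes ind: "trop_independent c S" and gen: "\<And>i. \<exists>a. c i = (\<Sum>l\<in>S. a l *s c l)"
    and eX: "e ** X = X" and eY: "e ** Y = Y" and XY: "X ** Y = e" and YX: "Y ** X = e"
    and ee: "e ** e = e"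
    and j: "j \<in> S"
  shows "\<exists>k\<in>S. \<exists>r. X *v c j = Fin r *s c k"
proof -
  \<comment> \<open>The equation \<open>e ** Z = Z\<close> puts every value of \<open>Z\<close> into
    the column space of \<open>e\<close>: applying \<open>e\<close> to a vector combines the columns
    of \<open>e\<close> with the entries of that vector as coefficients.\<close>
  have span: "\<exists>a. Z *v c i = (\<Sum>l\<in>S. a l *s c l)" if eZ: "e ** Z = Z" for Z i
  proof -
    have "\<forall>i. \<exists>a. c i = (\<Sum>l\<in>S. a l *s c l)"
      using gen by blast
    then obtain a where a: "\<And>i. c i = (\<Sum>l\<in>S. a i l *s c l)"
      by metis
    have "Z *v c i = e *v (Z *v c i)"
      by (simp add: matrix_vector_mul_assoc eZ)
    also have "\<dots> = (\<Sum>m\<in>UNIV. (Z *v c i) $ m *s c m)"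
      by (simp add: vec_eq_iff matrix_vector_mult_def c_def column_def mult.commute)
    also have "\<dots> = (\<Sum>m\<in>UNIV. (Z *v c i) $ m *s (\<Sum>l\<in>S. a m l *s c l))"
      by (rule sum.cong[OF refl]) (subst a, rule refl)
    also have "\<dots> = (\<Sum>m\<in>UNIV. \<Sum>l\<in>S. ((Z *v c i) $ m * a m l) *s c l)"
      by (simp add: vec_eq_iff sum_distrib_left mult.assoc)
    also have "\<dots> = (\<Sum>l\<in>S. (\<Sum>m\<in>UNIV. (Z *v c i) $ m * a m l) *s c l)"
      by (subst sum.swap) (simp add: vec_eq_iff sum_distrib_right)
    finally show ?thesis by (intro exI)
  qed
  have fix_c: "e *v c i = c i" for i
    using column_matrix_mult[of i e e] by (simp add: c_def ee)
  obtain a where a: "X *v c j = (\<Sum>k\<in>S. a k *s c k)"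
    using span[OF eX] by blast
  have "\<forall>k. \<exists>b. Y *v c k = (\<Sum>l\<in>S. b l *s c l)"
    using span[OF eY] by blast
  then obtain b where b: "\<And>k. Y *v c k = (\<Sum>l\<in>S. b k l *s c l)"
    by metis
  \<comment> \<open>Expanding the round trip in the generators exposes the coefficient of
    \<open>c j\<close>, which independence then determines.\<close>
  have "c j = Y *v (X *v c j)"
    by (simp add: matrix_vector_mul_assoc YX fix_c)
  also have "\<dots> = (\<Sum>k\<in>S. a k *s (\<Sum>l\<in>S. b k l *s c l))"
    by (simp add: a matrix_vector_mult_sum_smult b)
  also have "\<dots> = (\<Sum>k\<in>S. \<Sum>l\<in>S. (a k * b k l) *s c l)"
    by (simp add: vec_eq_iff sum_distrib_left mult.assoc)
  also have "\<dots> = (\<Sum>l\<in>S. (\<Sum>k\<in>S. a k * b k l) *s c l)"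
    by (subst sum.swap) (simp add: vec_eq_iff sum_distrib_right)
  finally have one: "(\<Sum>k\<in>S. a k * b k j) = 1"
    by (rule trop_independent_coeff[OF ind j])
  \<comment> \<open>This \<open>k\<close> attains the maximum. Since the product equals
    \<open>1\<close>, that is \<open>Fin 0\<close>, the factor \<open>a k\<close> is finite and
    \<open>b k j\<close> is its inverse.\<close>
  then obtain k where k: "k \<in> S" "a k * b k j = 1"
    using trop_sum_attained[of S "\<lambda>k. a k * b k j"] by (metis finite zero_neq_one)
  text \<open>Both \<open>a k *s c k \<le> X *v c j\<close> and \<open>b k j *s c j \<le> Y *v c k\<close>; applying \<open>X\<close> to the latter
    reverses the former.\<close>
  have "(X *v c j) $ i = (a k *s c k) $ i" for i
  proof (rule antisym)
    show "(a k *s c k) $ i \<le> (X *v c j) $ i"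
      using trop_member_le_sum[of S k "\<lambda>k. a k * c k $ i"] k by (simp add: a)
    have "(b k j *s c j) $ i \<le> (Y *v c k) $ i" for i
      using trop_member_le_sum[of S j "\<lambda>l. b k l * c l $ i"] j by (simp add: b)
    then have "(X *v (b k j *s c j)) $ i \<le> (X *v (Y *v c k)) $ i"
      by (rule trop_matrix_mult_mono)
    then have "b k j * (X *v c j) $ i \<le> c k $ i"
      by (simp add: matrix_vector_mult_smult matrix_vector_mul_assoc XY fix_c)
    then have "a k * (b k j * (X *v c j) $ i) \<le> a k * c k $ i"
      by (rule trop_mult_left_mono)
    then show "(X *v c j) $ i \<le> (a k *s c k) $ i"
      by (simp add: k flip: mult.assoc)
  qed
  then have "X *v c j = a k *s c k"
    by (simp add: vec_eq_iff)
  moreover obtain r where "a k = Fin r"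
    using k(2) by (cases "a k") (auto simp: one_trop_def)
  ultimately show ?thesis
    using k by auto
qed

section \<open>The monomial action of a tropical matrix group\<close>

theorem theorem2p5:
  fixes G :: "('a, 'b) monoid_scheme"
    and H :: "(trop ^ 'n ^ 'n) set"
    and e :: "trop ^ 'n ^ 'n"
  assumes "group G"
    and "group (trop_mat_structure H e)"
    and "G \<cong> trop_mat_structure H e"
  shows "\<exists>A. subgroup A G
    \<and> comm_group (G\<lparr>carrier := A\<rparr>)
    \<and> torsion_free (G\<lparr>carrier := A\<rparr>)
    \<and> finite (rcosets\<^bsub>G\<^esub> A)
    \<and> card (rcosets\<^bsub>G\<^esub> A) \<le> fact CARD('n)"
proof -
  interpret group G by fact
  obtain \<phi> where "\<phi> \<in> iso G (trop_mat_structure H e)"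
    using assms(3) unfolding is_iso_def by blast
  then have hom: "\<phi> \<in> hom G (trop_mat_structure H e)" and inj: "inj_on \<phi> (carrier G)"
    by (auto simp: iso_def bij_betw_def)
  have \<phi>_mult: "\<phi> (g \<otimes>\<^bsub>G\<^esub> h) = \<phi> g ** \<phi> h" if "g \<in> carrier G" "h \<in> carrier G" for g h
    using hom_mult[OF hom that] by (simp add: trop_mat_structure_def)
  have \<phi>_one: "\<phi> \<one>\<^bsub>G\<^esub> = e"
    using hom_one[OF hom assms(1,2)] by (simp add: trop_mat_structure_def)
  \<comment> \<open>As \<open>e\<close> may differ from \<open>mat 1\<close>, these laws are
    transported from \<open>G\<close> and not taken from matrix algebra.\<close>
  have unit: "\<phi> g ** e = \<phi> g" "e ** \<phi> g = \<phi> g" "\<phi> g ** \<phi> (inv\<^bsub>G\<^esub> g) = e"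
    "\<phi> (inv\<^bsub>G\<^esub> g) ** \<phi> g = e" if "g \<in> carrier G" for g
    using that by (simp_all flip: \<phi>_one \<phi>_mult)
  have ee: "e ** e = e"
    using unit(1)[of "\<one>\<^bsub>G\<^esub>"] by (simp add: \<phi>_one)
  define c where "c j = column j e" for j
  have fix_c: "e *v c i = c i" for i
    using column_matrix_mult[of i e e] by (simp add: c_def ee)
  obtain S where ind: "trop_independent c S" and gen: "\<And>i. \<exists>a. c i = (\<Sum>l\<in>S. a l *s c l)"
    by (rule exists_independent_generators[of c]) blast
  have "\<exists>k r. k \<in> S \<and> \<phi> g *v c j = Fin r *s c k" if "g \<in> carrier G" "j \<in> S" for g j
    using invertible_action_monomial[of e S "\<phi> g" "\<phi> (inv\<^bsub>G\<^esub> g)" j] ind gen ee that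
      unit[of g] unit[of "inv\<^bsub>G\<^esub> g"]
    unfolding c_def[abs_def] by auto
  \<comment> \<open>The values are merely chosen, but each is unique by
    \<open>trop_independent_multiples\<close>. Evaluating a product of group elements on
    \<open>c j\<close> in two ways therefore yields the composition rules.\<close>
  then obtain \<sigma> w where \<sigma>_in: "\<And>g j. g \<in> carrier G \<Longrightarrow> j \<in> S \<Longrightarrow> \<sigma> g j \<in> S"
    and act: "\<And>g j. g \<in> carrier G \<Longrightarrow> j \<in> S \<Longrightarrow> \<phi> g *v c j = Fin (w g j) *s c (\<sigma> g j)"
    by metis
  have mult: "\<sigma> (g \<otimes>\<^bsub>G\<^esub> h) j = \<sigma> g (\<sigma> h j) \<and> w (g \<otimes>\<^bsub>G\<^esub> h) j = w h j + w g (\<sigma> h j)"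
    if "g \<in> carrier G" "h \<in> carrier G" "j \<in> S" for g h j
  proof (rule trop_independent_multiples[OF ind])
    have "Fin (w (g \<otimes>\<^bsub>G\<^esub> h) j) *s c (\<sigma> (g \<otimes>\<^bsub>G\<^esub> h) j) = \<phi> g *v (\<phi> h *v c j)"
      using that by (simp add: matrix_vector_mul_assoc \<phi>_mult flip: act)
    also have "\<dots> = Fin (w h j + w g (\<sigma> h j)) *s c (\<sigma> g (\<sigma> h j))"
      using that by (simp add: act matrix_vector_mult_smult \<sigma>_in vector_smult_assoc)
    finally show "Fin (w (g \<otimes>\<^bsub>G\<^esub> h) j) *s c (\<sigma> (g \<otimes>\<^bsub>G\<^esub> h) j)
      = Fin (w h j + w g (\<sigma> h j)) *s c (\<sigma> g (\<sigma> h j))" .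
  qed (use that \<sigma>_in in auto)
  have "\<exists>A. subgroup A G \<and> comm_group (G\<lparr>carrier := A\<rparr>) \<and> torsion_free (G\<lparr>carrier := A\<rparr>)
    \<and> finite (rcosets\<^bsub>G\<^esub> A) \<and> card (rcosets\<^bsub>G\<^esub> A) \<le> fact (card S)"
  proof (rule torsion_free_subgroup_from_monomial_action[where \<sigma> = \<sigma> and w = w])
    fix j assume j: "j \<in> S"
    have "Fin (w \<one>\<^bsub>G\<^esub> j) *s c (\<sigma> \<one>\<^bsub>G\<^esub> j) = Fin 0 *s c j"
      using j fix_c by (simp add: \<phi>_one flip: act one_trop_def)
    then show "\<sigma> \<one>\<^bsub>G\<^esub> j = j"
      using trop_independent_multiples[OF ind] j \<sigma>_in by blast
  next
    fix g assume g: "g \<in> carrier G" and triv: "\<And>j. j \<in> S \<Longrightarrow> \<sigma> g j = j \<and> w g j = 0"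
    \<comment> \<open>Fixing the generators means fixing every column of \<open>e\<close>, so
      \<open>\<phi> g ** e = e\<close>; the left side is \<open>\<phi> g\<close> by the unit
      law.\<close>
    have "\<phi> g *v c i = c i" for i
    proof -
      obtain a where a: "c i = (\<Sum>l\<in>S. a l *s c l)"
        using gen by blast
      have "\<phi> g *v c l = c l" if "l \<in> S" for l
        using act[OF g that] triv[OF that] by (simp flip: one_trop_def)
      then show ?thesis
        by (simp add: a matrix_vector_mult_sum_smult)
    qed
    then have "column i (\<phi> g ** e) = column i e" for i
      by (simp add: column_matrix_mult c_def)
    then have "\<phi> g = \<phi> \<one>\<^bsub>G\<^esub>"
      using unit(1)[OF g] by (simp add: vec_eq_iff column_def \<phi>_one)
    then show "g = \<one>\<^bsub>G\<^esub>"
      using inj g by (auto dest: inj_onD)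
  qed (use assms(1) \<sigma>_in mult in auto)
  \<comment> \<open>The elements of \<open>S\<close> index columns of \<open>e\<close>, so there are
    at most \<open>CARD('n)\<close> of them.\<close>
  moreover have "fact (card S) \<le> (fact CARD('n) :: nat)"
    by (intro fact_mono card_mono) auto
  ultimately show ?thesis
    using order_trans by blast
qed

end
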